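(* Let $\mathbb{F}$ be an algebraically closed field of characteristic not two, let $n\ge 3$, and let $X:V^{n-1}\to V$ be an $(n-1)$-fold cross product on the $n$-dimensional $\mathbb{F}$-vector space $V$, relative to a nondegenerate symmetric bilinear form $b$. Let $G$ be an abelian group. Then any $G$-grading on $(V,X)$ is isomorphic to a grading $\Gamma(G,\delta)$ for a unique map $\delta:G\to\mathbb{Z}_{\ge 0}$ satisfying the restrictions: (a) $\sum_{g\in G}\delta(g)=n$; (b) $\delta(g)=\delta(g^{-1}h)$ for all $g\in G$, where $h=\prod_{g\in G}g^{\delta(g)}$.
   Context: An $r$-fold cross product on $V$ relative to a nondegenerate symmetric bilinear form $b$ is a multilinear map $X:V^r\to V$ such that, for all $v_1,\dots,v_r\in V$, $b(X(v_1,\dots,v_r),v_i)=0$ for $1\le i\le r$, and $b(X(v_1,\dots,v_r),X(v_1,\dots,v_r))=\det\big(b(v_i,v_j)\big)$. For an abelian group $G$ (written multiplicatively), a $G$-grading on $(V,X)$ is a vector space decomposition $V=\bigoplus_{g\in G}V_g$ with $X(V_{g_1},\dots,V_{g_r})\subseteq V_{g_1\cdots g_r}$ for all $g_i\in G$. Two $G$-gradings $V=\bigoplus_g V_g=\bigoplus_g V'_g$ on $(V,X)$ are isomorphic if there is a linear automorphism $\varphi$ of $V$ commuting with $X$ (i.e. $\varphi(X(v_1,\dots,v_r))=X(\varphi(v_1),\dots,\varphi(v_r))$) such that $\varphi(V_g)=V'_g$ for all $g\in G$. For a map $\delta:G\to\mathbb{Z}_{\ge0}$ satisfying (a) and (b),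 $\Gamma(G,\delta)$ denotes the $G$-grading $V=\bigoplus_{g\in G}V_g$ on $(V,X)$ with $\dim_{\mathbb{F}}V_g=\delta(g)$ for all $g$ and $b(V_g,V_{g'})=0$ unless $gg'=h$; such a vector space decomposition exists, is a $G$-grading on $(V,X)$, and is unique up to isomorphism of gradings. *)

theory Defs
  imports "HOL-Analysis.Determinants" "HOL-Algebra.FiniteProduct"
    "HOL-Computational_Algebra.Polynomial"
begin

text \<open>
  The vector space \<open>V\<close> is a whole type \<open>'v\<close> with scalar multiplication \<open>smul\<close>.
  The power \<open>V\<^sup>r\<close> is the type \<open>'r \<Rightarrow> 'v\<close> over a finite index type \<open>'r\<close> with
  \<open>CARD('r) = r\<close>. The order of the arguments plays no role in any notion below.
\<close>

definition bilinear_form :: "('f::field \<Rightarrow> 'v::ab_group_add \<Rightarrow> 'v) \<Rightarrow> ('v \<Rightarrow> 'v \<Rightarrow> 'f) \<Rightarrow> bool" where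
  "bilinear_form smul b \<longleftrightarrow>
     (\<forall>x. Vector_Spaces.linear smul (*) (\<lambda>y. b x y)) \<and>
     (\<forall>y. Vector_Spaces.linear smul (*) (\<lambda>x. b x y))"

definition symmetric_form :: "('v \<Rightarrow> 'v \<Rightarrow> 'f) \<Rightarrow> bool" where
  "symmetric_form b \<longleftrightarrow> (\<forall>x y. b x y = b y x)"

definition nondegenerate_form :: "('v::zero \<Rightarrow> 'v \<Rightarrow> 'f::zero) \<Rightarrow> bool" where
  "nondegenerate_form b \<longleftrightarrow> (\<forall>x. (\<forall>y. b x y = 0) \<longrightarrow> x = 0)"

definition multilinear_map ::
  "('f::field \<Rightarrow> 'v::ab_group_add \<Rightarrow> 'v) \<Rightarrow> (('r \<Rightarrow> 'v) \<Rightarrow> 'v) \<Rightarrow> bool" where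
  "multilinear_map smul X \<longleftrightarrow>
     (\<forall>v i. Vector_Spaces.linear smul smul (\<lambda>x. X (v(i := x))))"

definition cross_product ::
  "('f::field \<Rightarrow> 'v::ab_group_add \<Rightarrow> 'v) \<Rightarrow> ('v \<Rightarrow> 'v \<Rightarrow> 'f) \<Rightarrow> (('r::finite \<Rightarrow> 'v) \<Rightarrow> 'v) \<Rightarrow> bool"
where
  "cross_product smul b X \<longleftrightarrow>
     multilinear_map smul X \<and>
     (\<forall>v i. b (X v) (v i) = 0) \<and>
     (\<forall>v. b (X v) (X v) = det (\<chi> i j. b (v i) (v j)))"

text \<open>A family \<open>U\<close> of subsets of \<open>V\<close> matters only at the indices in \<open>I\<close>.\<close>

definition direct_sum_decomposition ::
  "('f::field \<Rightarrow> 'v::ab_group_add \<Rightarrow> 'v) \<Rightarrow> 'g set \<Rightarrow> ('g \<Rightarrow> 'v set) \<Rightarrow> bool" where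
  "direct_sum_decomposition smul I U \<longleftrightarrow>
     (\<forall>g\<in>I. module.subspace smul (U g)) \<and>
     (\<forall>v. \<exists>!c. (\<forall>g\<in>I. c g \<in> U g) \<and> (\<forall>g. g \<notin> I \<longrightarrow> c g = 0) \<and>
               finite {g. c g \<noteq> 0} \<and> v = (\<Sum>g | c g \<noteq> 0. c g))"

definition is_grading ::
  "('f::field \<Rightarrow> 'v::ab_group_add \<Rightarrow> 'v) \<Rightarrow> (('r::finite \<Rightarrow> 'v) \<Rightarrow> 'v) \<Rightarrow>
   ('g, 'm) monoid_scheme \<Rightarrow> ('g \<Rightarrow> 'v set) \<Rightarrow> bool" where
  "is_grading smul X G U \<longleftrightarrow>
     direct_sum_decomposition smul (carrier G) U \<and>
     (\<forall>\<gamma> v. (\<forall>i. \<gamma> i \<in> carrier G) \<and> (\<forall>i. v i \<in> U (\<gamma> i)) \<longrightarrow>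
        X v \<in> U (finprod G \<gamma> UNIV))"

definition isomorphic_gradings ::
  "('f::field \<Rightarrow> 'v::ab_group_add \<Rightarrow> 'v) \<Rightarrow> (('r::finite \<Rightarrow> 'v) \<Rightarrow> 'v) \<Rightarrow>
   ('g, 'm) monoid_scheme \<Rightarrow> ('g \<Rightarrow> 'v set) \<Rightarrow> ('g \<Rightarrow> 'v set) \<Rightarrow> bool" where
  "isomorphic_gradings smul X G U U' \<longleftrightarrow>
     (\<exists>\<phi>. Vector_Spaces.linear smul smul \<phi> \<and> bij \<phi> \<and>
          (\<forall>v. \<phi> (X v) = X (\<lambda>i. \<phi> (v i))) \<and>
          (\<forall>g\<in>carrier G. \<phi> ` U g = U' g))"

definition support_on :: "('g, 'm) monoid_scheme \<Rightarrow> ('g \<Rightarrow> nat) \<Rightarrow> 'g set" where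
  "support_on G \<delta> = {g \<in> carrier G. \<delta> g \<noteq> 0}"

text \<open>The element \<open>h\<close>. The product runs over the support of \<open>\<delta>\<close>, since
  \<open>finprod\<close> over an infinite set is \<open>\<one>\<close> by convention.\<close>

definition total_degree :: "('g, 'm) monoid_scheme \<Rightarrow> ('g \<Rightarrow> nat) \<Rightarrow> 'g" where
  "total_degree G \<delta> = finprod G (\<lambda>g. g [^]\<^bsub>G\<^esub> \<delta> g) (support_on G \<delta>)"

text \<open>\<open>W\<close> is a grading with the properties that define \<open>\<Gamma>(G,\<delta>)\<close>; such a grading is
  determined by \<open>\<delta>\<close> only up to isomorphism.\<close>

definition is_Gamma ::
  "('f::field \<Rightarrow> 'v::ab_group_add \<Rightarrow> 'v) \<Rightarrow> ('v \<Rightarrow> 'v \<Rightarrow> 'f) \<Rightarrow> (('r::finite \<Rightarrow> 'v) \<Rightarrow> 'v) \<Rightarrow>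
   ('g, 'm) monoid_scheme \<Rightarrow> ('g \<Rightarrow> nat) \<Rightarrow> ('g \<Rightarrow> 'v set) \<Rightarrow> bool" where
  "is_Gamma smul b X G \<delta> W \<longleftrightarrow>
     is_grading smul X G W \<and>
     (\<forall>g\<in>carrier G. vector_space.dim smul (W g) = \<delta> g) \<and>
     (\<forall>g\<in>carrier G. \<forall>g'\<in>carrier G. g \<otimes>\<^bsub>G\<^esub> g' \<noteq> total_degree G \<delta> \<longrightarrow>
        (\<forall>x\<in>W g. \<forall>y\<in>W g'. b x y = 0))"

text \<open>``Isomorphic to \<open>\<Gamma>(G,\<delta>)\<close>'': a grading as above exists, and \<open>U\<close> is isomorphic to
  it, whichever representative is chosen.\<close>

definition isomorphic_to_Gamma ::
  "('f::field \<Rightarrow> 'v::ab_group_add \<Rightarrow> 'v) \<Rightarrow> ('v \<Rightarrow> 'v \<Rightarrow> 'f) \<Rightarrow> (('r::finite \<Rightarrow> 'v) \<Rightarrow> 'v) \<Rightarrow>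
   ('g, 'm) monoid_scheme \<Rightarrow> ('g \<Rightarrow> nat) \<Rightarrow> ('g \<Rightarrow> 'v set) \<Rightarrow> bool" where
  "isomorphic_to_Gamma smul b X G \<delta> U \<longleftrightarrow>
     (\<exists>W. is_Gamma smul b X G \<delta> W) \<and>
     (\<forall>W. is_Gamma smul b X G \<delta> W \<longrightarrow> isomorphic_gradings smul X G U W)"

end

theory Submission
  imports Defs
begin

text \<open>
  The form \<open>vol v = b (X v\<^sub>1 \<dots> v\<^sub>n\<^sub>-\<^sub>1) v\<^sub>n\<close> is alternating and nonzero, hence nonzero on every
  basis. For a homogeneous basis \<open>v\<close> with degrees \<open>\<gamma>\<close> and \<open>h = \<Prod>\<gamma>\<^sub>i\<close>, the value of \<open>X\<close> on all basis
  vectors but \<open>v\<^sub>i\<close> is therefore a nonzero multiple of the dual basis vector of \<open>v\<^sub>i\<close>, and it has degree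
  \<open>h\<close> divided by \<open>\<gamma>\<^sub>i\<close>. So \<open>b\<close> pairs \<open>U\<^sub>g\<close> only with the component of degree \<open>g\<inverse>h\<close>, perfectly. Over an
  algebraically closed field of characteristic not two, the pairs of components have a normal form
  depending only on dimensions, which yields an isometry between any two gradings with the same
  dimensions. An isometry multiplies \<open>vol\<close> by a constant, and since \<open>n \<ge> 3\<close> a suitable scalar multiple
  of it commutes with \<open>X\<close>.
\<close>

subsection \<open>Alternating forms\<close>

text \<open>The arguments are indexed by a type without an order, so no sign convention enters.
  Alternation is vanishing on a repeated argument, which is the right notion in every
  characteristic.\<close>

definition alternating_form ::
  "('f::field \<Rightarrow> 'v::ab_group_add \<Rightarrow> 'v) \<Rightarrow> (('k \<Rightarrow> 'v) \<Rightarrow> 'f) \<Rightarrow> bool" where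
  "alternating_form smul F \<longleftrightarrow>
     (\<forall>v i. Vector_Spaces.linear smul (*) (\<lambda>x. F (v(i := x)))) \<and>
     (\<forall>v i j. i \<noteq> j \<longrightarrow> v i = v j \<longrightarrow> F v = 0)"

context vector_space
begin

text \<open>Polarization: put x + y into both slots \<open>i\<close> and \<open>j\<close> and
  expand. The terms with a repeated argument vanish, and the two mixed terms must cancel.\<close>

lemma alternating_form_transpose:
  assumes F: "alternating_form scale F" and ij: "i \<noteq> j"
  shows "F (v \<circ> Transposition.transpose i j) = - F v"
proof -
  let ?w = "\<lambda>x y. v(i := x, j := y)"
  have lin1: "F (?w (x + y) z) = F (?w x z) + F (?w y z)" for x y z
  proof -
    interpret L: Vector_Spaces.linear scale "(*)" "\<lambda>x. F ((v(j := z))(i := x))"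
      using F unfolding alternating_form_def by blast
    show ?thesis using L.add[of x y] ij by (simp add: fun_upd_twist)
  qed
  have lin2: "F (?w z (x + y)) = F (?w z x) + F (?w z y)" for x y z
  proof -
    interpret L: Vector_Spaces.linear scale "(*)" "\<lambda>x. F ((v(i := z))(j := x))"
      using F unfolding alternating_form_def by blast
    show ?thesis using L.add[of x y] by simp
  qed
  have alt: "F (?w x x) = 0" for x
  proof -
    have "?w x x i = ?w x x j" by simp
    then show ?thesis using F ij unfolding alternating_form_def by blast
  qed
  have "F (?w x y) + F (?w y x) = 0" for x y
    using alt[of "x + y"] alt[of x] alt[of y] unfolding lin1 lin2 by (simp add: add.commute)
  from this[of "v i" "v j"] have swap: "F v + F (?w (v j) (v i)) = 0" by simp
  moreover have "v \<circ> Transposition.transpose i j = ?w (v j) (v i)"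
    using ij by (auto simp: fun_eq_iff Transposition.transpose_def)
  ultimately show ?thesis by (simp add: eq_neg_iff_add_eq_0 add.commute)
qed

lemma alternating_form_permutation_eq_0:
  fixes F :: "('k::finite \<Rightarrow> 'b) \<Rightarrow> 'a"
  assumes F: "alternating_form scale F" and p: "p permutes UNIV" and v: "F v = 0"
  shows "F (v \<circ> p) = 0"
proof -
  \<comment> \<open>The family stays quantified because each transposition of the induction is
    absorbed into it. Only vanishing is tracked, so the sign of \<open>p\<close> never has to be
    computed.\<close>
  from p finite have "\<forall>v. F v = 0 \<longrightarrow> F (v \<circ> p) = 0"
  proof (induction rule: permutes_induct)
    case id
    show ?case by simp
  next
    case (swap a b p)
    show ?case
      by (metis F swap.IH swap.hyps(3) alternating_form_transpose comp_assoc neg_equal_0_iff_equal)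
  qed
  with v show ?thesis by blast
qed

text \<open>By linearity the arguments may be replaced one at a time by members of the spanning
  family. A tuple of such members either repeats one of them or is a permutation of
  \<open>v\<close>, and \<open>F\<close> vanishes in both cases.\<close>

lemma alternating_form_eq_0:
  fixes F :: "('k::finite \<Rightarrow> 'b) \<Rightarrow> 'a"
  assumes F: "alternating_form scale F" and v: "F v = 0" and span: "span (range v) = UNIV"
  shows "F w = 0"
proof -
  \<comment> \<open>\<open>S\<close> is the set of positions whose arguments are still arbitrary;
    the induction empties it.\<close>
  have "F w = 0" if "finite S" "\<And>i. i \<notin> S \<Longrightarrow> w i \<in> range v" for S w
    using that
  proof (induction arbitrary: w rule: finite_induct)
    case empty
    then have "\<forall>i. \<exists>j. w i = v j" by blast
    then obtain f where f: "\<And>i. w i = v (f i)" by metis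
    show ?case
    proof (cases "inj f")
      case True
      then have "f permutes UNIV"
        by (intro bij_imp_permutes) (simp_all add: bij_def finite_UNIV_inj_surj)
      moreover have "w = v \<circ> f" using f by auto
      ultimately show ?thesis using alternating_form_permutation_eq_0[OF F _ v] by simp
    next
      case False
      then obtain i j where "i \<noteq> j" "f i = f j" unfolding inj_def by blast
      then show ?thesis using F f unfolding alternating_form_def by metis
    qed
  next
    case (insert i S)
    interpret L: Vector_Spaces.linear scale "(*)" "\<lambda>x. F (w(i := x))"
      using F unfolding alternating_form_def by blast
    have "F (w(i := x)) = 0" if "x \<in> range v" for x
      by (rule insert.IH) (use that insert.prems in auto)
    then have "F (w(i := w i)) = 0"
      using L.eq_0_on_span[of "range v" "w i"] span by blast
    then show ?case by simp
  qed
  from this[of UNIV w] show ?thesis by simp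
qed

text \<open>Alternating forms with as many arguments as a spanning family has members are
  proportional: as a function of \<open>w\<close>, the difference of the two sides is alternating
  and vanishes at \<open>v\<close>.\<close>

lemma alternating_form_unique:
  fixes F F' :: "('k::finite \<Rightarrow> 'b) \<Rightarrow> 'a"
  assumes F: "alternating_form scale F" and F': "alternating_form scale F'"
    and span: "span (range v) = UNIV"
  shows "F w * F' v = F' w * F v"
proof -
  have lin: "Vector_Spaces.linear scale (*) (\<lambda>x. F (w(i := x)) * F' v - F' (w(i := x)) * F v)" for w i
  proof -
    interpret L: Vector_Spaces.linear scale "(*)" "\<lambda>x. F (w(i := x))"
      using F unfolding alternating_form_def by blast
    interpret L': Vector_Spaces.linear scale "(*)" "\<lambda>x. F' (w(i := x))"
      using F' unfolding alternating_form_def by blast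
    show ?thesis by unfold_locales (simp_all add: L.add L'.add L.scale L'.scale algebra_simps)
  qed
  have "alternating_form scale (\<lambda>w. F w * F' v - F' w * F v)"
    unfolding alternating_form_def
  proof (intro conjI allI impI)
    fix w :: "'k \<Rightarrow> 'b" and i j
    assume "i \<noteq> j" "w i = w j"
    then have "F w = 0" "F' w = 0" using F F' unfolding alternating_form_def by blast+
    then show "F w * F' v - F' w * F v = 0" by simp
  qed (rule lin)
  from alternating_form_eq_0[OF this _ span, of w] show ?thesis by simp
qed

end

subsection \<open>Direct sum decompositions\<close>

context vector_space
begin

text \<open>Extended by zero, the family \<open>c\<close> decomposes the zero vector, and so does
  the zero family. Uniqueness of the decomposition identifies them.\<close>

lemma direct_sum_zero:
  assumes U: "direct_sum_decomposition scale I U"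
    and K: "finite K" "K \<subseteq> I" and c: "\<And>g. g \<in> K \<Longrightarrow> c g \<in> U g" and "sum c K = 0" and "g \<in> K"
  shows "c g = 0"
proof -
  have sub: "subspace (U g)" if "g \<in> I" for g
    using U that unfolding direct_sum_decomposition_def by blast
  define P where "P = (\<lambda>c. (\<forall>g\<in>I. c g \<in> U g) \<and> (\<forall>g. g \<notin> I \<longrightarrow> c g = 0) \<and>
               finite {g. c g \<noteq> 0} \<and> 0 = (\<Sum>g | c g \<noteq> 0. c g))"
  let ?c = "\<lambda>g. if g \<in> K then c g else 0"
  have ex1: "\<exists>!c. P c" using U unfolding P_def direct_sum_decomposition_def by blast
  have fin: "finite {g. ?c g \<noteq> 0}" by (rule finite_subset[OF _ K(1)]) auto
  have "(\<Sum>g | ?c g \<noteq> 0. ?c g) = sum ?c K"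
    by (rule sum.mono_neutral_left) (use K in auto)
  also have "\<dots> = 0" using assms(5) by simp
  finally have "(\<Sum>g | ?c g \<noteq> 0. ?c g) = 0" .
  then have "P ?c" unfolding P_def using fin K c sub subspace_0 by auto
  moreover have "P (\<lambda>g. 0)" unfolding P_def using sub subspace_0 by auto
  ultimately have "?c = (\<lambda>g. 0)" using ex1 by blast
  then show ?thesis using \<open>g \<in> K\<close> by (meson)
qed

lemma direct_sum_span:
  assumes "direct_sum_decomposition scale I U"
  shows "span (\<Union>g\<in>I. U g) = UNIV"
proof -
  have "v \<in> span (\<Union>g\<in>I. U g)" for v
  proof -
    obtain c where c: "\<forall>g\<in>I. c g \<in> U g" "\<forall>g. g \<notin> I \<longrightarrow> c g = 0" "v = (\<Sum>g | c g \<noteq> 0. c g)"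
      using assms unfolding direct_sum_decomposition_def by meson
    then show ?thesis unfolding c(3) by (intro span_sum span_base) auto
  qed
  then show ?thesis by blast
qed

text \<open>Bases of the components are united into one basis of the whole space and then numbered
  by the type \<open>'k\<close>. The function \<open>\<gamma>\<close> records the degree of each
  basis vector.\<close>

lemma homogeneous_basis:
  assumes U: "direct_sum_decomposition scale I U" and n: "dim UNIV = CARD('k)"
  obtains v :: "'k::finite \<Rightarrow> 'b" and \<gamma> :: "'k \<Rightarrow> 'g"
  where "inj v" "independent (range v)" "span (range v) = UNIV" "\<And>i. \<gamma> i \<in> I"
    "\<And>g. g \<in> I \<Longrightarrow> U g = span (v ` {i. \<gamma> i = g})"
proof -
  have sub: "subspace (U g)" if "g \<in> I" for g
    using U that unfolding direct_sum_decomposition_def by blast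
  have "\<forall>g. \<exists>B. B \<subseteq> U g \<and> independent B \<and> U g \<subseteq> span B"
    by (meson basis_exists)
  then obtain B where B: "\<And>g. B g \<subseteq> U g" "\<And>g. independent (B g)" "\<And>g. U g \<subseteq> span (B g)"
    by metis
  \<comment> \<open>A vector common to two components would give the nontrivial relation x + (-x) =
    0 between them.\<close>
  have disj: "g = g'" if "g \<in> I" "g' \<in> I" "x \<in> B g" "x \<in> B g'" for g g' x
  proof (rule ccontr)
    assume ne: "g \<noteq> g'"
    have "x \<in> U g" "x \<in> U g'" using B(1) that by auto
    let ?c = "\<lambda>k. if k = g then x else - x"
    have c: "?c k \<in> U k" if "k \<in> {g, g'}" for k
      using that \<open>x \<in> U g\<close> subspace_neg[OF sub[OF \<open>g' \<in> I\<close>] \<open>x \<in> U g'\<close>] by auto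
    have "sum ?c {g, g'} = 0" using ne by simp
    then have "?c g = 0"
      by (intro direct_sum_zero[OF U, of "{g, g'}" ?c] c) (use that in auto)
    then have "x = 0" by simp
    then show False using B(2)[of g] that dependent_zero by blast
  qed
  define BB where "BB = (\<Union>g\<in>I. B g)"
  have "\<forall>x. \<exists>g. x \<in> BB \<longrightarrow> g \<in> I \<and> x \<in> B g" unfolding BB_def by blast
  then obtain d where d: "\<And>x. x \<in> BB \<Longrightarrow> d x \<in> I" "\<And>x. x \<in> BB \<Longrightarrow> x \<in> B (d x)" by metis
  have B_eq: "B g = {x \<in> BB. d x = g}" if "g \<in> I" for g
    using that d disj unfolding BB_def by blast
  have indep: "independent BB"
    unfolding independent_explicit_module
  proof (intro allI impI)
    fix t u x assume t: "finite t" "t \<subseteq> BB" and s: "(\<Sum>x\<in>t. scale (u x) x) = 0" and x: "x \<in> t"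
    \<comment> \<open>A linear relation is grouped by degree. Each homogeneous part vanishes by
      directness of the sum, and then independence inside a single component applies.\<close>
    let ?c = "\<lambda>g. \<Sum>x\<in>{x\<in>t. d x = g}. scale (u x) x"
    have "sum ?c (d ` t) = 0" using sum.group[of t "d ` t" d "\<lambda>x. scale (u x) x"] t s by simp
    moreover have "?c g \<in> U g" if "g \<in> d ` t" for g
    proof (intro subspace_sum subspace_scale)
      show "subspace (U g)" using that t d sub by blast
      show "subspace (U g)" using that t d sub by blast
      show "x \<in> U g" if "x \<in> {x\<in>t. d x = g}" for x using that t d B(1) by blast
    qed
    ultimately have "?c (d x) = 0"
      using t d x by (intro direct_sum_zero[OF U, of "d ` t" ?c]) auto
    moreover have "{y\<in>t. d y = d x} \<subseteq> B (d x)"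
    proof
      fix y assume "y \<in> {y\<in>t. d y = d x}"
      then show "y \<in> B (d x)" using d(2)[of y] t by auto
    qed
    ultimately show "u x = 0"
      using independentD[OF B(2)[of "d x"], of "{y\<in>t. d y = d x}" u x] t x by simp
  qed
  have spn: "span BB = UNIV"
  proof -
    have "U g \<subseteq> span BB" if "g \<in> I" for g
    proof -
      have "span (B g) \<subseteq> span BB" using that unfolding BB_def by (intro span_mono) auto
      then show ?thesis using B(3) by blast
    qed
    then have "span (\<Union>g\<in>I. U g) \<subseteq> span BB" by (intro span_minimal) auto
    then show ?thesis using direct_sum_span[OF U] by blast
  qed
  have "card BB = CARD('k)" using dim_eq_card[of BB UNIV] indep spn n by simp
  moreover from this have "finite BB" by (metis card.infinite finite_UNIV_card_ge_0 finite less_irrefl)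
  ultimately obtain v :: "'k \<Rightarrow> 'b" where v: "bij_betw v UNIV BB"
    using finite_same_card_bij[of "UNIV :: 'k set" BB] by auto
  have rv: "range v = BB" using v by (simp add: bij_betw_def)
  show thesis
  proof (rule that[of v "d \<circ> v"])
    show "inj v" using v by (simp add: bij_betw_def)
    show "independent (range v)" "span (range v) = UNIV" using indep spn rv by auto
    show "(d \<circ> v) i \<in> I" for i using d rv by auto
    show "U g = span (v ` {i. (d \<circ> v) i = g})" if "g \<in> I" for g
    proof -
      have "v ` {i. (d \<circ> v) i = g} = B g" unfolding B_eq[OF that] rv[symmetric] by auto
      then show ?thesis using span_subspace[OF B(1,3) sub[OF that]] by simp
    qed
  qed
qed

end

subsection \<open>Nondegenerate symmetric bilinear forms\<close>

locale symmetric_form_space = finite_dimensional_vector_space scale Basis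
  for scale :: "'f::alg_closed_field \<Rightarrow> 'v::ab_group_add \<Rightarrow> 'v" and Basis :: "'v set" +
  fixes b :: "'v \<Rightarrow> 'v \<Rightarrow> 'f"
  assumes bilinear: "bilinear_form scale b" and symmetric: "symmetric_form b"
    and nondegenerate: "nondegenerate_form b" and two_neq_0: "(2::'f) \<noteq> 0"
begin

lemma b_linear_left: "Vector_Spaces.linear scale (*) (\<lambda>x. b x y)"
  and b_linear_right: "Vector_Spaces.linear scale (*) (\<lambda>y. b x y)"
  using bilinear unfolding bilinear_form_def by blast+

lemma b_commute: "b x y = b y x"
  using symmetric unfolding symmetric_form_def by blast

lemma b_left:
  shows b_0_left: "b 0 y = 0" and b_add_left: "b (x + x') y = b x y + b x' y"
    and b_diff_left: "b (x - x') y = b x y - b x' y" and b_scale_left: "b (scale c x) y = c * b x y"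
    and b_sum_left: "b (sum f A) y = (\<Sum>a\<in>A. b (f a) y)"
proof -
  interpret L: Vector_Spaces.linear scale "(*)" "\<lambda>x. b x y" by (rule b_linear_left)
  show "b 0 y = 0" "b (x + x') y = b x y + b x' y" "b (x - x') y = b x y - b x' y"
    "b (scale c x) y = c * b x y" "b (sum f A) y = (\<Sum>a\<in>A. b (f a) y)"
    by (fact L.zero L.add L.diff L.scale L.sum)+
qed

lemma b_right:
  shows b_0_right: "b y 0 = 0" and b_add_right: "b y (x + x') = b y x + b y x'"
    and b_diff_right: "b y (x - x') = b y x - b y x'" and b_scale_right: "b y (scale c x) = c * b y x"
    and b_sum_right: "b y (sum f A) = (\<Sum>a\<in>A. b y (f a))"
  by (simp_all only: b_commute[of y] b_left)

lemma b_eq_0_on_span: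
  assumes "\<And>s. s \<in> S \<Longrightarrow> b x s = 0" and "y \<in> span S"
  shows "b x y = 0"
proof -
  interpret L: Vector_Spaces.linear scale "(*)" "\<lambda>y. b x y" by (rule b_linear_right)
  show ?thesis using L.eq_0_on_span assms by blast
qed

lemma eq_0_if_orthogonal:
  assumes "span S = UNIV" and "\<And>s. s \<in> S \<Longrightarrow> b x s = 0"
  shows "x = 0"
  using assms b_eq_0_on_span nondegenerate unfolding nondegenerate_form_def by blast

lemma dual_family_inj_on:
  assumes "\<And>i j. i \<in> A \<Longrightarrow> j \<in> A \<Longrightarrow> b (x i) (v j) = (if i = j then 1 else 0)"
  shows "inj_on v A"
proof (rule inj_onI)
  fix i j assume ij: "i \<in> A" "j \<in> A" "v i = v j"
  show "i = j"
  proof (rule ccontr)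
    assume "i \<noteq> j"
    then show False using assms[OF ij(1,1)] assms[OF ij(1,2)] ij(3) by simp
  qed
qed

text \<open>Pairing a linear relation with \<open>x i\<close> isolates the coefficient of
  \<open>v i\<close>.\<close>

lemma dual_family_independent:
  assumes dual: "\<And>i j. i \<in> A \<Longrightarrow> j \<in> A \<Longrightarrow> b (x i) (v j) = (if i = j then 1 else 0)"
  shows "independent (v ` A)"
  unfolding independent_explicit_module
proof (intro allI impI)
  fix t u w assume t: "finite t" "t \<subseteq> v ` A" and s: "(\<Sum>w\<in>t. scale (u w) w) = 0" and w: "w \<in> t"
  obtain i where i: "i \<in> A" "w = v i" using t w by blast
  have "b (x i) y = (if y = w then 1 else 0)" if y: "y \<in> t" for y
  proof -
    obtain j where j: "j \<in> A" "y = v j" using t y by blast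
    then show ?thesis using dual[OF i(1) j(1)] dual_family_inj_on[of A x v, OF dual] i
      by (auto simp: inj_on_def)
  qed
  then have "(\<Sum>y\<in>t. u y * b (x i) y) = (\<Sum>y\<in>t. if y = w then u y else 0)"
    by (intro sum.cong) auto
  also have "\<dots> = u w" using t w by simp
  finally have "b (x i) (\<Sum>w\<in>t. scale (u w) w) = u w" by (simp add: b_right)
  then show "u w = 0" by (simp add: s b_right)
qed

text \<open>The two sides have the same pairing with every \<open>v j\<close>, and these span, so
  nondegeneracy makes them equal.\<close>

lemma dual_expansion:
  assumes A: "finite A" and span: "span (v ` A) = UNIV"
    and dual: "\<And>i j. i \<in> A \<Longrightarrow> j \<in> A \<Longrightarrow> b (x i) (v j) = (if i = j then 1 else 0)"
  shows "y = (\<Sum>i\<in>A. scale (b y (v i)) (x i))"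
proof -
  have "b (y - (\<Sum>i\<in>A. scale (b y (v i)) (x i))) s = 0" if s: "s \<in> v ` A" for s
  proof -
    obtain j where j: "j \<in> A" "s = v j" using s by blast
    have "(\<Sum>i\<in>A. b y (v i) * b (x i) (v j)) = (\<Sum>i\<in>A. if i = j then b y (v i) else 0)"
      by (intro sum.cong) (use dual j in auto)
    then show ?thesis using A j by (simp add: b_left)
  qed
  from eq_0_if_orthogonal[OF span this] show ?thesis by simp
qed

lemma dual_span:
  assumes "finite A" and "span (v ` A) = UNIV"
    and "\<And>i j. i \<in> A \<Longrightarrow> j \<in> A \<Longrightarrow> b (x i) (v j) = (if i = j then 1 else 0)"
  shows "span (x ` A) = UNIV"
proof -
  have "y \<in> span (x ` A)" for y
    by (subst dual_expansion[OF assms]) (auto intro: span_sum span_scale span_base)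
  then show ?thesis by blast
qed

text \<open>A largest orthonormal subset \<open>E\<close> of \<open>P\<close> is taken. A vector of
  \<open>P\<close> orthogonal to \<open>E\<close> must be isotropic, for otherwise a square root
  would normalize it and enlarge \<open>E\<close>. By polarization the form vanishes on the
  orthogonal complement of \<open>E\<close> in \<open>P\<close>, which then lies in the radical of
  \<open>P\<close> and is zero.\<close>

lemma orthonormal_basis_exists:
  assumes P: "subspace P" and nd: "\<And>x. x \<in> P \<Longrightarrow> (\<And>y. y \<in> P \<Longrightarrow> b x y = 0) \<Longrightarrow> x = 0"
  obtains E where "finite E" "E \<subseteq> P" "independent E" "span E = P"
    "\<And>x y. x \<in> E \<Longrightarrow> y \<in> E \<Longrightarrow> b x y = (if x = y then 1 else 0)"
proof -
  define Q where "Q E \<longleftrightarrow> E \<subseteq> P \<and> (\<forall>x\<in>E. \<forall>y\<in>E. b x y = (if x = y then 1 else 0))" for E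
  have indep: "independent E" if "Q E" for E
    using dual_family_independent[of E "\<lambda>x. x" "\<lambda>x. x"] that unfolding Q_def by simp
  have fin: "finite E" and card: "card E \<le> dim UNIV" if "Q E" for E
    using indep[OF that] finiteI_independent independent_card_le_dim[of E UNIV] by auto
  \<comment> \<open>Orthonormal sets are independent, so the dimension bounds their size and a
    maximum exists.\<close>
  obtain E where E: "Q E" and max: "\<And>E'. Q E' \<Longrightarrow> card E' \<le> card E"
    using ex_has_greatest_nat[of Q "{}" card "Suc (dim UNIV)"] card by (auto simp: Q_def less_Suc_eq_le)
  \<comment> \<open>\<open>p\<close> is the orthogonal projection onto the complement of
    \<open>E\<close>.\<close>
  define p where "p y = y - (\<Sum>e\<in>E. scale (b y e) e)" for y
  have pP: "p y \<in> P" if "y \<in> P" for y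
    unfolding p_def using P E that
    by (intro subspace_diff subspace_sum subspace_scale) (auto simp: Q_def)
  have pE: "b (p y) e = 0" if e: "e \<in> E" for y e
  proof -
    have "(\<Sum>i\<in>E. b y i * b i e) = (\<Sum>i\<in>E. if i = e then b y i else 0)"
      by (intro sum.cong) (use E e in \<open>auto simp: Q_def\<close>)
    then show ?thesis unfolding p_def using fin[OF E] e by (simp add: b_left)
  qed
  define P' where "P' = {x \<in> P. \<forall>e\<in>E. b x e = 0}"
  have iso: "b x x = 0" if x: "x \<in> P'" for x
  proof (rule ccontr)
    assume nz: "b x x \<noteq> 0"
    obtain c where c: "c ^ 2 = b x x" using nth_root_exists[of 2 "b x x"] by auto
    then have c0: "c \<noteq> 0" using nz by auto
    let ?e = "scale (inverse c) x"
    have 1: "b ?e ?e = 1" using c0 by (simp add: b_left b_right c [symmetric] power2_eq_square field_simps)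
    have 0: "b ?e e = 0" "b e ?e = 0" if "e \<in> E" for e
      using x that b_commute[of e x] by (auto simp: P'_def b_left b_right)
    have "?e \<notin> E" using 0 1 by (metis zero_neq_one)
    moreover have "Q (insert ?e E)"
      using E x 0 1 \<open>?e \<notin> E\<close> subspace_scale[OF P] unfolding Q_def P'_def by auto
    ultimately show False using max[of "insert ?e E"] fin[OF E] by simp
  qed
  have null: "b x y = 0" if "x \<in> P'" "y \<in> P'" for x y
  proof -
    have "x + y \<in> P'" using that subspace_add[OF P] by (auto simp: P'_def b_left)
    then have "2 * b x y = 0"
      using iso[of "x + y"] iso[OF that(1)] iso[OF that(2)] b_commute[of y x]
      by (simp add: b_left b_right)
    then show ?thesis using two_neq_0 by simp
  qed
  have "p y = 0" if y: "y \<in> P" for y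
  proof (rule nd[OF pP[OF y]])
    have py: "p y \<in> P'" using pP[OF y] pE by (simp add: P'_def)
    fix z assume z: "z \<in> P"
    have "b (p y) (p z) = 0" using null[OF py] pP[OF z] pE by (simp add: P'_def)
    moreover have "b (p y) (p z) = b (p y) z"
      unfolding p_def[of z] by (simp add: b_right pE)
    ultimately show "b (p y) z = 0" by simp
  qed
  then have exp: "y = (\<Sum>e\<in>E. scale (b y e) e)" if "y \<in> P" for y
    using that unfolding p_def by simp
  have "P \<subseteq> span E"
  proof
    fix y assume "y \<in> P"
    then show "y \<in> span E" by (subst exp) (auto intro: span_sum span_scale span_base)
  qed
  moreover have "E \<subseteq> P" using E by (simp add: Q_def)
  ultimately show thesis
    using that[of E] fin[OF E] indep[OF E] E P span_minimal[of E P] unfolding Q_def by auto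
qed

text \<open>The dual family \<open>e'\<close> reads off coordinates with respect to
  \<open>e\<close>, which gives a formula for the map sending \<open>e\<close> to \<open>f\<close>.
  Equal Gram matrices make it an isometry, and an isometry of a nondegenerate form is
  injective.\<close>

lemma isometry_exists:
  assumes A: "finite A" and e: "span (e ` A) = UNIV" and f: "span (f ` A) = UNIV"
    and dual: "\<And>k l. k \<in> A \<Longrightarrow> l \<in> A \<Longrightarrow> b (e' k) (e l) = (if k = l then 1 else 0)"
    and gram: "\<And>k l. k \<in> A \<Longrightarrow> l \<in> A \<Longrightarrow> b (f k) (f l) = b (e k) (e l)"
  obtains \<phi> where "Vector_Spaces.linear scale scale \<phi>" "bij \<phi>" "\<And>x y. b (\<phi> x) (\<phi> y) = b x y"
    "\<And>k. k \<in> A \<Longrightarrow> \<phi> (e k) = f k"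
proof -
  define \<phi> where "\<phi> x = (\<Sum>k\<in>A. scale (b x (e' k)) (f k))" for x
  interpret \<phi>: Vector_Spaces.linear scale scale \<phi>
    by unfold_locales
      (simp_all add: \<phi>_def b_left scale_left_distrib sum.distrib scale_sum_right)
  have \<phi>_e: "\<phi> (e k) = f k" if k: "k \<in> A" for k
  proof -
    have "\<phi> (e k) = (\<Sum>l\<in>A. if l = k then f l else 0)"
      unfolding \<phi>_def by (intro sum.cong) (use dual k b_commute[of "e k"] in auto)
    then show ?thesis using A k by simp
  qed
  \<comment> \<open>The equality of Gram matrices is extended linearly in one argument here and in
    the other argument afterwards.\<close>
  have iso1: "b (\<phi> x) (f l) = b x (e l)" if l: "l \<in> A" for x l
  proof -
    interpret L: Vector_Spaces.linear scale "(*)" "\<lambda>x. b (\<phi> x) (f l) - b x (e l)"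
      by unfold_locales (simp_all add: \<phi>.add \<phi>.scale b_left algebra_simps)
    have "b (\<phi> s) (f l) - b s (e l) = 0" if "s \<in> e ` A" for s
      using that l \<phi>_e gram by auto
    then show ?thesis using L.eq_0_on_span[of "e ` A" x] e by simp
  qed
  have iso: "b (\<phi> x) (\<phi> y) = b x y" for x y
  proof -
    interpret L: Vector_Spaces.linear scale "(*)" "\<lambda>y. b (\<phi> x) (\<phi> y) - b x y"
      by unfold_locales (simp_all add: \<phi>.add \<phi>.scale b_right algebra_simps)
    have "b (\<phi> x) (\<phi> s) - b x s = 0" if "s \<in> e ` A" for s
      using that iso1 \<phi>_e by auto
    then show ?thesis using L.eq_0_on_span[of "e ` A" y] e by simp
  qed
  have "inj \<phi>"
    unfolding \<phi>.inj_iff_eq_0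
  proof (intro allI impI)
    fix x assume "\<phi> x = 0"
    then have "b x y = 0" for y using iso[of x y] by (simp add: b_left)
    then show "x = 0" using eq_0_if_orthogonal[of UNIV] by simp
  qed
  moreover have "surj \<phi>"
  proof -
    have "f ` A = \<phi> ` e ` A" using \<phi>_e by (force simp: image_image)
    then show ?thesis using f e \<phi>.span_image[of "e ` A"] by simp
  qed
  ultimately show thesis using that[of \<phi>] \<phi>.linear_axioms iso \<phi>_e by (simp add: bij_def)
qed

end

subsection \<open>Cross products\<close>

locale cross_product_space = symmetric_form_space scale Basis b
  for scale :: "'f::alg_closed_field \<Rightarrow> 'v::ab_group_add \<Rightarrow> 'v" and Basis :: "'v set" and b +
  fixes X :: "('r::finite \<Rightarrow> 'v) \<Rightarrow> 'v"
  assumes cross: "cross_product scale b X" and dim_UNIV_eq: "dim UNIV = Suc CARD('r)"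
begin

lemma X_linear: "Vector_Spaces.linear scale scale (\<lambda>x. X (w(i := x)))"
  using cross unfolding cross_product_def multilinear_map_def by blast

lemma X_orthogonal: "b (X w) (w i) = 0"
  using cross unfolding cross_product_def by blast

text \<open>The type \<open>'r option\<close> has as many elements as the dimension, so it can index
  a basis. The index \<open>None\<close> marks the slot outside \<open>X\<close>.\<close>

definition vol :: "('r option \<Rightarrow> 'v) \<Rightarrow> 'f" where
  "vol v = b (X (v \<circ> Some)) (v None)"

text \<open>Polarization of the orthogonality of \<open>X (w(i := z))\<close> and z.\<close>

lemma X_skew: "b (X (w(i := x))) y = - b (X (w(i := y))) x"
proof -
  interpret L: Vector_Spaces.linear scale scale "\<lambda>x. X (w(i := x))" by (rule X_linear)
  have "b (X (w(i := z))) z = 0" for z using X_orthogonal[of "w(i := z)" i] by simp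
  from this[of "x + y"] this[of x] this[of y]
  have "b (X (w(i := x))) y + b (X (w(i := y))) x = 0"
    unfolding L.add by (simp add: b_left b_right add.commute)
  then show ?thesis by (simp add: eq_neg_iff_add_eq_0)
qed

lemma alternating_vol: "alternating_form scale vol"
  unfolding alternating_form_def
proof (intro conjI allI impI)
  fix v :: "'r option \<Rightarrow> 'v" and i
  show "Vector_Spaces.linear scale (*) (\<lambda>x. vol (v(i := x)))"
  proof (cases i)
    case None
    then have "(v(i := x)) \<circ> Some = v \<circ> Some" for x by auto
    then show ?thesis using None b_linear_right by (simp add: vol_def)
  next
    case (Some j)
    then have *: "(v(i := x)) \<circ> Some = (v \<circ> Some)(j := x)" for x by auto
    interpret L: Vector_Spaces.linear scale scale "\<lambda>x. X ((v \<circ> Some)(j := x))" by (rule X_linear)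
    show ?thesis using Some unfolding vol_def *
      by unfold_locales (simp_all add: L.add L.scale b_left algebra_simps)
  qed
next
  fix v :: "'r option \<Rightarrow> 'v" and i j
  assume ij: "i \<noteq> j" and eq: "v i = v j"
  have o: "b (X (v \<circ> Some)) (v (Some k)) = 0" for k
    using X_orthogonal[of "v \<circ> Some" k] by simp
  consider "i = None" | "j = None" | k l where "i = Some k" "j = Some l" by (meson option.exhaust)
  then show "vol v = 0"
  proof cases
    case 1
    then obtain k where "j = Some k" using ij by (cases j) auto
    then show ?thesis using o[of k] eq 1 by (simp add: vol_def)
  next
    case 2
    then obtain k where "i = Some k" using ij by (cases i) auto
    then show ?thesis using o[of k] eq 2 by (simp add: vol_def)
  next
    case 3
    \<comment> \<open>For a repetition inside \<open>X\<close>, skewness exchanges one of the two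
      equal vectors with the vector in the slot \<open>None\<close>. The other copy remains an
      argument of \<open>X\<close>, so orthogonality applies.\<close>
    let ?w = "(v \<circ> Some)(k := v None)"
    have "b (X ((v \<circ> Some)(k := v i))) (v None) = - b (X ?w) (v i)" by (rule X_skew)
    moreover have "(v \<circ> Some)(k := v i) = v \<circ> Some" using 3 by auto
    moreover have "b (X ?w) (v i) = 0" using X_orthogonal[of ?w l] 3 ij eq by simp
    ultimately show ?thesis by (simp add: vol_def)
  qed
qed

text \<open>If \<open>vol\<close> vanished on a spanning family it would vanish identically, and
  nondegeneracy would force \<open>X\<close> to be zero. But on orthonormal arguments the Gram
  determinant is 1, so the value of \<open>X\<close> there has norm 1.\<close>

lemma vol_nonzero:
  assumes "span (range v) = UNIV"
  shows "vol v \<noteq> 0"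
proof
  assume v: "vol v = 0"
  obtain E where E: "finite E" "independent E" "span E = UNIV"
    "\<And>x y. x \<in> E \<Longrightarrow> y \<in> E \<Longrightarrow> b x y = (if x = y then 1 else 0)"
    using orthonormal_basis_exists[of UNIV] nondegenerate
    unfolding nondegenerate_form_def by auto
  have "card E = Suc CARD('r)" using E dim_eq_card[of E UNIV] dim_UNIV_eq by simp
  then obtain w :: "'r \<Rightarrow> 'v" where w: "range w \<subseteq> E" "inj w"
    using card_le_inj[of "UNIV :: 'r set" E] E by auto
  have "X w = 0"
  proof (rule eq_0_if_orthogonal[of UNIV])
    fix y
    have "vol (case_option y w) = 0" by (rule alternating_form_eq_0[OF alternating_vol v assms])
    moreover have "case_option y w \<circ> Some = w" by auto
    ultimately show "b (X w) y = 0" by (simp add: vol_def)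
  qed simp
  moreover have "b (X w) (X w) = det (\<chi> i j. b (w i) (w j))"
    using cross unfolding cross_product_def by blast
  moreover have "(\<chi> i j. b (w i) (w j)) = mat 1"
    using w E(4) unfolding mat_def by (auto simp: vec_eq_iff inj_def image_subset_iff)
  ultimately show False by (simp add: b_left)
qed

text \<open>The transposition moves \<open>v i\<close> to the slot \<open>None\<close>, so
  \<open>x i\<close> is \<open>X\<close> applied to all members except \<open>v i\<close>. Its
  pairing with \<open>v i\<close> is a value of \<open>vol\<close> on a spanning family, and any
  other \<open>v j\<close> is an argument of \<open>X\<close>. Up to scalars this is the dual
  basis.\<close>

lemma X_omit:
  assumes "span (range v) = UNIV"
  defines "x \<equiv> \<lambda>i. X (v \<circ> Transposition.transpose None i \<circ> Some)"
  shows "b (x i) (v i) \<noteq> 0" and "i \<noteq> j \<Longrightarrow> b (x i) (v j) = 0"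
proof -
  let ?p = "Transposition.transpose None i"
  have "range (v \<circ> ?p) = range v"
    using bij_is_surj[OF bij_transpose[of None i]] by (metis image_comp)
  with vol_nonzero[of "v \<circ> ?p"] assms(1) show "b (x i) (v i) \<noteq> 0" by (simp add: vol_def x_def)
  show "b (x i) (v j) = 0" if ij: "i \<noteq> j"
  proof -
    have "?p j \<noteq> None" using ij by (auto simp: Transposition.transpose_def)
    then obtain k where "?p j = Some k" by blast
    then have "j = ?p (Some k)" by (metis Transposition.transpose_involutory)
    then show ?thesis using X_orthogonal[of "v \<circ> ?p \<circ> Some" k] by (simp add: x_def)
  qed
qed

lemma X_scale: "X (\<lambda>i. scale c (w i)) = scale (c ^ CARD('r)) (X w)"
proof -
  \<comment> \<open>The scalar is pulled out of one position at a time; \<open>S\<close> is the set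
    of scaled positions.\<close>
  have "X (\<lambda>i. if i \<in> S then scale c (w i) else w i) = scale (c ^ card S) (X w)" if "finite S" for S
    using that
  proof induction
    case (insert i S)
    let ?w = "\<lambda>i. if i \<in> S then scale c (w i) else w i"
    interpret L: Vector_Spaces.linear scale scale "\<lambda>x. X (?w(i := x))" by (rule X_linear)
    have "(\<lambda>j. if j \<in> insert i S then scale c (w j) else w j) = ?w(i := scale c (w i))" by auto
    moreover have "?w(i := w i) = ?w" using insert.hyps by auto
    ultimately show ?case
      using L.scale[of c "w i"] insert by simp
  qed simp
  from this[of UNIV] show ?thesis by simp
qed

text \<open>An isometry \<open>\<phi>\<close> multiplies \<open>vol\<close> by a constant \<open>\<epsilon>\<close> (its determinant), so that
  \<open>X (\<phi> \<circ> w) = \<epsilon> \<phi> (X w)\<close>; the scaling by \<open>\<mu>\<close> with \<open>\<mu>\<^bsup>n-2\<^esup> = \<epsilon>\<inverse>\<close> corrects this.\<close>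

lemma scaled_isometry_preserves_X:
  assumes \<phi>: "Vector_Spaces.linear scale scale \<phi>" "bij \<phi>" and iso: "\<And>x y. b (\<phi> x) (\<phi> y) = b x y"
    and r: "CARD('r) \<ge> 2"
  obtains \<mu> where "\<mu> \<noteq> 0" "\<And>w. scale \<mu> (\<phi> (X w)) = X (\<lambda>i. scale \<mu> (\<phi> (w i)))"
proof -
  interpret \<phi>: Vector_Spaces.linear scale scale \<phi> by (rule \<phi>(1))
  let ?vol' = "\<lambda>v. vol (\<phi> \<circ> v)"
  have alt: "alternating_form scale ?vol'"
    unfolding alternating_form_def
  proof (intro conjI allI impI)
    fix v :: "'r option \<Rightarrow> 'v" and i j
    show "?vol' v = 0" if "i \<noteq> j" "v i = v j"
      using alternating_vol that unfolding alternating_form_def by (metis comp_apply)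
  next
    fix v :: "'r option \<Rightarrow> 'v" and i
    interpret L: Vector_Spaces.linear scale "(*)" "\<lambda>x. vol ((\<phi> \<circ> v)(i := x))"
      using alternating_vol unfolding alternating_form_def by blast
    have "\<phi> \<circ> v(i := x) = (\<phi> \<circ> v)(i := \<phi> x)" for x by auto
    then show "Vector_Spaces.linear scale (*) (\<lambda>x. ?vol' (v(i := x)))"
      by unfold_locales (simp_all add: \<phi>.add \<phi>.scale L.add L.scale algebra_simps)
  qed
  have "card Basis = CARD('r option)" using dim_UNIV_eq by (simp add: card_UNIV_option)
  then obtain v :: "'r option \<Rightarrow> 'v" where "bij_betw v UNIV Basis"
    using finite_same_card_bij[of "UNIV :: 'r option set" Basis] finite_Basis by auto
  then have v: "span (range v) = UNIV" by (simp add: bij_betw_def span_Basis)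
  \<comment> \<open>By uniqueness of alternating forms, the ratio on a single basis is the ratio
    everywhere.\<close>
  define \<epsilon> where "\<epsilon> = ?vol' v / vol v"
  have "range (\<phi> \<circ> v) = \<phi> ` range v" by auto
  then have "span (range (\<phi> \<circ> v)) = UNIV"
    using \<phi>.span_image[of "range v"] v bij_is_surj[OF \<phi>(2)] by simp
  then have \<epsilon>: "\<epsilon> \<noteq> 0" unfolding \<epsilon>_def using vol_nonzero v by simp
  have vol': "?vol' w = \<epsilon> * vol w" for w
    using alternating_form_unique[OF alt alternating_vol v, of w] vol_nonzero[OF v]
    unfolding \<epsilon>_def by (simp add: field_simps)
  have X_\<phi>: "X (\<phi> \<circ> w) = scale \<epsilon> (\<phi> (X w))" for w
  proof -
    have "b (X (\<phi> \<circ> w) - scale \<epsilon> (\<phi> (X w))) y = 0" for y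
    proof -
      \<comment> \<open>Surjectivity lets every test vector be written as \<open>\<phi> z\<close>,
        so that the isometry property applies to the second term.\<close>
      obtain z where z: "y = \<phi> z" using bij_is_surj[OF \<phi>(2)] by (metis surjD)
      have "vol (case_option z w) = b (X w) z"
        and "?vol' (case_option z w) = b (X (\<phi> \<circ> w)) y"
        by (simp_all add: vol_def o_def z)
      then show ?thesis using vol'[of "case_option z w"] by (simp add: b_left z iso)
    qed
    then show ?thesis using eq_0_if_orthogonal[of UNIV "X (\<phi> \<circ> w) - scale \<epsilon> (\<phi> (X w))"] by simp
  qed
  \<comment> \<open>The exponent is positive because \<open>X\<close> has at least two arguments, so
    algebraic closedness supplies the root.\<close>
  obtain \<mu> where \<mu>: "\<mu> ^ (CARD('r) - 1) = inverse \<epsilon>"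
    using nth_root_exists[of "CARD('r) - 1" "inverse \<epsilon>"] r by auto
  show thesis
  proof (rule that[of \<mu>])
    show "\<mu> \<noteq> 0" using \<mu> \<epsilon> r by (auto simp: power_0_left)
    have "\<mu> ^ CARD('r) = \<mu> * inverse \<epsilon>"
      using \<mu> r by (metis One_nat_def Suc_pred power_Suc zero_less_card_finite)
    then show "scale \<mu> (\<phi> (X w)) = X (\<lambda>i. scale \<mu> (\<phi> (w i)))" for w
      using X_scale[of \<mu> "\<phi> \<circ> w"] X_\<phi>[of w] \<epsilon> by simp
  qed
qed

end

subsection \<open>Gradings\<close>

text \<open>The numbers \<open>\<delta> g\<close> are the fibre sizes of the degree function
  \<open>\<gamma>\<close>, so sums and products regroup along the fibres. Thus the total degree is
  the product of the degrees of any homogeneous basis.\<close>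

lemma (in comm_group)
  fixes \<gamma> :: "'k::finite \<Rightarrow> 'a"
  assumes \<gamma>: "\<And>i. \<gamma> i \<in> carrier G" and \<delta>: "\<And>g. g \<in> carrier G \<Longrightarrow> \<delta> g = card {i. \<gamma> i = g}"
  shows support_on_eq_range: "support_on G \<delta> = range \<gamma>"
    and sum_support_on: "(\<Sum>g\<in>support_on G \<delta>. \<delta> g) = CARD('k)"
    and total_degree_eq: "total_degree G \<delta> = finprod G \<gamma> UNIV"
proof -
  show S: "support_on G \<delta> = range \<gamma>"
    using \<gamma> \<delta> by (auto simp: support_on_def card_gt_0_iff)
  have "(\<Sum>g\<in>range \<gamma>. \<delta> g) = (\<Sum>g\<in>range \<gamma>. \<Sum>i\<in>{i\<in>UNIV. \<gamma> i = g}. 1)"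
    using \<gamma> \<delta> by (intro sum.cong) auto
  also have "\<dots> = (\<Sum>i\<in>(UNIV :: 'k set). 1)" by (intro sum.group) auto
  finally show "(\<Sum>g\<in>support_on G \<delta>. \<delta> g) = CARD('k)" by (simp add: S)
  have "finprod G \<gamma> UNIV = finprod G \<gamma> (\<Union>g\<in>range \<gamma>. {i. \<gamma> i = g})"
    by (rule arg_cong[where f = "finprod G \<gamma>"]) auto
  also have "\<dots> = finprod G (\<lambda>g. finprod G \<gamma> {i. \<gamma> i = g}) (range \<gamma>)"
    by (intro finprod_UN_disjoint) (auto simp: pairwise_def disjnt_def \<gamma>)
  also have "\<dots> = finprod G (\<lambda>g. g [^] \<delta> g) (range \<gamma>)"
  proof (rule finprod_cong')
    fix g assume "g \<in> range \<gamma>"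
    then have g: "g \<in> carrier G" using \<gamma> by auto
    have "finprod G \<gamma> {i. \<gamma> i = g} = finprod G (\<lambda>_. g) {i. \<gamma> i = g}"
      by (intro finprod_cong') (use g in auto)
    then show "finprod G \<gamma> {i. \<gamma> i = g} = g [^] \<delta> g" using \<delta>[OF g] finprod_const[OF g] by simp
  qed (use \<gamma> in auto)
  finally show "total_degree G \<delta> = finprod G \<gamma> UNIV" by (simp add: total_degree_def S)
qed

text \<open>This is the degree of the value of \<open>X\<close> with the \<open>i\<close>-th basis
  vector omitted. Reindexing by the transposition moves the factor \<open>\<gamma> i\<close> to
  \<open>None\<close>, where it splits off.\<close>

lemma (in comm_group) finprod_omit:
  fixes \<gamma> :: "'r::finite option \<Rightarrow> 'a"
  assumes \<gamma>: "\<And>i. \<gamma> i \<in> carrier G"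
  shows "finprod G (\<gamma> \<circ> Transposition.transpose None i \<circ> Some) UNIV = inv (\<gamma> i) \<otimes> finprod G \<gamma> UNIV"
proof -
  let ?p = "Transposition.transpose None i"
  have "finprod G \<gamma> UNIV = finprod G (\<lambda>j. \<gamma> (?p j)) UNIV"
    using finprod_reindex[of \<gamma> ?p UNIV, OF _ bij_is_inj[OF bij_transpose]] \<gamma>
    unfolding surj_transpose by blast
  also have "\<dots> = finprod G (\<lambda>j. \<gamma> (?p j)) (insert None (range Some))"
    by (simp add: UNIV_option_conv)
  also have "\<dots> = \<gamma> i \<otimes> finprod G (\<lambda>j. \<gamma> (?p j)) (range Some)"
    using \<gamma> by (subst finprod_insert) auto
  also have "finprod G (\<lambda>j. \<gamma> (?p j)) (range Some) = finprod G (\<gamma> \<circ> ?p \<circ> Some) UNIV"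
    using finprod_reindex[of "\<lambda>j. \<gamma> (?p j)" Some UNIV] \<gamma> by (simp add: o_def)
  finally show ?thesis using \<gamma> by (simp add: inv_solve_left)
qed

section \<open>Duality of homogeneous components and isomorphism of gradings\<close>

locale cross_product_graded_by =
  cross_product_space scale Basis b X + comm_group G
  for scale :: "'f::alg_closed_field \<Rightarrow> 'v::ab_group_add \<Rightarrow> 'v" and Basis :: "'v set" and b
    and X :: "('r::finite \<Rightarrow> 'v) \<Rightarrow> 'v" and G :: "('g, 'm) monoid_scheme" (structure)
begin

abbreviation dims :: "('g \<Rightarrow> 'v set) \<Rightarrow> 'g \<Rightarrow> nat" where
  "dims U \<equiv> \<lambda>g. dim (U g)"

text \<open>The dual basis of a homogeneous basis is obtained by rescaling the values of
  \<open>X\<close> with one basis vector omitted, and the grading condition gives the degrees of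
  these values.\<close>

lemma homogeneous_dual_bases:
  assumes U: "is_grading scale X G U"
  obtains v x :: "'r option \<Rightarrow> 'v" and \<gamma> where "span (range v) = UNIV"
    "\<And>i. \<gamma> i \<in> carrier G" "\<And>g. g \<in> carrier G \<Longrightarrow> U g = span (v ` {i. \<gamma> i = g})"
    "\<And>g. g \<in> carrier G \<Longrightarrow> dim (U g) = card {i. \<gamma> i = g}"
    "\<And>i. x i \<in> U (inv (\<gamma> i) \<otimes> total_degree G (dims U))"
    "\<And>i j. b (x i) (v j) = (if i = j then 1 else 0)"
proof -
  have ds: "direct_sum_decomposition scale (carrier G) U"
    and X: "\<And>\<gamma> v. (\<And>i. \<gamma> i \<in> carrier G) \<Longrightarrow> (\<And>i. v i \<in> U (\<gamma> i)) \<Longrightarrow> X v \<in> U (finprod G \<gamma> UNIV)"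
    using U unfolding is_grading_def by blast+
  have "dim UNIV = CARD('r option)" by (simp add: dim_UNIV_eq[simplified] card_UNIV_option)
  then obtain v :: "'r option \<Rightarrow> 'v" and \<gamma> where v: "inj v" "independent (range v)" "span (range v) = UNIV"
    "\<And>i. \<gamma> i \<in> carrier G" "\<And>g. g \<in> carrier G \<Longrightarrow> U g = span (v ` {i. \<gamma> i = g})"
    using homogeneous_basis[OF ds] by blast
  have dimU: "dim (U g) = card {i. \<gamma> i = g}" if "g \<in> carrier G" for g
  proof -
    have "independent (v ` {i. \<gamma> i = g})" by (rule independent_mono[OF v(2)]) auto
    then have "dim (U g) = card (v ` {i. \<gamma> i = g})" using v(5)[OF that] by (simp add: dim_eq_card_independent)
    also have "\<dots> = card {i. \<gamma> i = g}" by (intro card_image inj_on_subset[OF v(1)]) auto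
    finally show ?thesis .
  qed
  have h: "total_degree G (dims U) = finprod G \<gamma> UNIV" by (rule total_degree_eq[OF v(4) dimU])
  define y where "y i = X (v \<circ> Transposition.transpose None i \<circ> Some)" for i
  note y = X_omit[OF v(3), folded y_def]
  define x where "x i = scale (inverse (b (y i) (v i))) (y i)" for i
  have hom: "v i \<in> U (\<gamma> i)" for i using v(4,5) by (auto intro: span_base)
  have "x i \<in> U (inv (\<gamma> i) \<otimes> total_degree G (dims U))" for i
  proof -
    have "y i \<in> U (inv (\<gamma> i) \<otimes> finprod G \<gamma> UNIV)"
      unfolding y_def finprod_omit[of \<gamma> i, OF v(4), symmetric] by (rule X) (use v(4) hom in auto)
    moreover have "subspace (U (inv (\<gamma> i) \<otimes> finprod G \<gamma> UNIV))"
      using v(4) by (simp add: v(5))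
    ultimately show ?thesis unfolding x_def h by (simp add: subspace_scale)
  qed
  moreover have "b (x i) (v j) = (if i = j then 1 else 0)" for i j
    using y[of i] by (auto simp: x_def b_left)
  ultimately show thesis using that[of v \<gamma> x] v dimU by blast
qed

lemma homogeneous_subspace:
  assumes U: "is_grading scale X G U" and "g \<in> carrier G"
  shows "subspace (U g)"
  using assms unfolding is_grading_def direct_sum_decomposition_def by blast

lemma total_degree_closed: "total_degree G \<delta> \<in> carrier G"
  unfolding total_degree_def by (intro finprod_closed) (auto simp: support_on_def)

lemma support_dims:
  assumes U: "is_grading scale X G U"
  shows "finite (support_on G (dims U))" and "(\<Sum>g\<in>support_on G (dims U). dim (U g)) = Suc CARD('r)"
proof -
  have "finite (support_on G (dims U)) \<and> (\<Sum>g\<in>support_on G (dims U). dim (U g)) = Suc CARD('r)"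
  proof (rule homogeneous_dual_bases[OF U])
    fix \<gamma> :: "'r option \<Rightarrow> 'g"
    assume \<gamma>: "\<And>i. \<gamma> i \<in> carrier G" "\<And>g. g \<in> carrier G \<Longrightarrow> dim (U g) = card {i. \<gamma> i = g}"
    have "support_on G (dims U) = range \<gamma>"
      by (rule support_on_eq_range[OF \<gamma>])
    then have 1: "finite (support_on G (dims U))" by simp
    have "(\<Sum>g\<in>support_on G (dims U). dim (U g)) = CARD('r option)"
      by (rule sum_support_on[OF \<gamma>])
    also have "\<dots> = Suc CARD('r)" by (simp add: card_UNIV_option)
    finally show ?thesis using 1 by blast
  qed
  then show "finite (support_on G (dims U))" "(\<Sum>g\<in>support_on G (dims U). dim (U g)) = Suc CARD('r)"
    by blast+
qed

text \<open>Expanded in the homogeneous dual basis, \<open>y\<close> involves only those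
  \<open>x i\<close> that have degree \<open>g'\<close>. These are dual to basis vectors of degree
  \<open>inv g' \<otimes> h\<close>, where \<open>h\<close> is the total degree, and so are
  orthogonal to the basis vectors of the different degree \<open>g\<close>.\<close>

lemma homogeneous_orthogonal:
  assumes U: "is_grading scale X G U" and g: "g \<in> carrier G" "g' \<in> carrier G"
    and ne: "g \<otimes> g' \<noteq> total_degree G (dims U)" and yz: "z \<in> U g" "y \<in> U g'"
  shows "b z y = 0"
proof -
  let ?h = "total_degree G (dims U)"
  obtain v x :: "'r option \<Rightarrow> 'v" and \<gamma> where v: "span (range v) = UNIV"
    "\<And>i. \<gamma> i \<in> carrier G" "\<And>g. g \<in> carrier G \<Longrightarrow> U g = span (v ` {i. \<gamma> i = g})"
    and x: "\<And>i. x i \<in> U (inv (\<gamma> i) \<otimes> ?h)"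
    "\<And>i j. b (x i) (v j) = (if i = j then 1 else 0)"
    by (rule homogeneous_dual_bases[OF U]) blast
  have hc: "?h \<in> carrier G" by (rule total_degree_closed)
  define d where "d i = inv (\<gamma> i) \<otimes> ?h" for i
  have d: "d i \<in> carrier G" for i using hc v(2) by (simp add: d_def)
  define y' where "y' = (\<Sum>i | d i = g'. scale (b y (v i)) (x i))"
  \<comment> \<open>This part, of degrees other than \<open>g'\<close>, turns out to be zero: it
    lies in the component of degree \<open>g'\<close> and also in the span of the remaining
    components.\<close>
  define y'' where "y'' = (\<Sum>i | d i \<noteq> g'. scale (b y (v i)) (x i))"
  have "y = (\<Sum>i\<in>UNIV. scale (b y (v i)) (x i))"
    using v x by (intro dual_expansion) auto
  also have "\<dots> = y' + y''"
    unfolding y'_def y''_def by (subst sum.union_disjoint[symmetric]) (auto intro!: sum.cong)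
  finally have y: "y = y' + y''" .
  have "y' \<in> U g'"
    unfolding y'_def using x(1) homogeneous_subspace[OF U g(2)] d_def
    by (intro subspace_sum subspace_scale) auto
  then have "y'' \<in> span (v ` {i. \<gamma> i = g'})"
    using y yz subspace_diff[OF homogeneous_subspace[OF U g(2)], of y y'] v(3)[OF g(2)] by simp
  moreover have "y'' \<in> span (v ` {i. \<gamma> i \<noteq> g'})"
    unfolding y''_def
  proof (intro span_sum span_scale)
    fix i assume "i \<in> {i. d i \<noteq> g'}"
    then have "span (v ` {j. \<gamma> j = d i}) \<subseteq> span (v ` {i. \<gamma> i \<noteq> g'})"
      by (intro span_mono) auto
    then show "x i \<in> span (v ` {i. \<gamma> i \<noteq> g'})"
      using x(1)[of i] v(3)[OF d[of i]] by (auto simp: d_def)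
  qed
  ultimately have "b y'' (x j) = 0" for j
  proof -
    have "b (x j) y'' = 0"
    \<comment> \<open>Each \<open>x j\<close> annihilates one of the two spans containing
      \<open>y''\<close>: the one whose generators do not include \<open>v j\<close>.\<close>
    proof (cases "\<gamma> j = g'")
      case True
      then show ?thesis
        by (intro b_eq_0_on_span[OF _ \<open>y'' \<in> span (v ` {i. \<gamma> i \<noteq> g'})\<close>]) (auto simp: x(2))
    next
      case False
      then show ?thesis
        by (intro b_eq_0_on_span[OF _ \<open>y'' \<in> span (v ` {i. \<gamma> i = g'})\<close>]) (auto simp: x(2))
    qed
    then show ?thesis by (simp add: b_commute)
  qed
  moreover have "span (range x) = UNIV"
    using dual_span[of UNIV v x] v(1) x(2) by simp
  ultimately have "y'' = 0" by (intro eq_0_if_orthogonal[of "range x"]) auto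
  then have "y = y'" using y by simp
  have "b y (v i) = 0" if "\<gamma> i = g" for i
  proof -
    have "d j \<noteq> g' \<or> j \<noteq> i" for j
      using ne g hc that v(2) by (auto simp: d_def inv_solve_left m_assoc [symmetric])
    then have "b y' (v i) = 0" unfolding y'_def using x(2) by (auto simp: b_left intro!: sum.neutral)
    then show ?thesis using \<open>y = y'\<close> by simp
  qed
  then have "b y s = 0" if "s \<in> v ` {i. \<gamma> i = g}" for s using that by auto
  then have "b y z = 0"
    using yz(1) unfolding v(3)[OF g(1)] by (rule b_eq_0_on_span)
  then show ?thesis by (simp add: b_commute)
qed

text \<open>If \<open>g \<otimes> g = h\<close>, the form is nondegenerate on \<open>U g\<close>,
  and an orthonormal basis serves as both families. Otherwise the basis vectors of degree
  \<open>g\<close> and their dual vectors are used.\<close>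

lemma dual_graded_bases:
  assumes U: "is_grading scale X G U" and g: "g \<in> carrier G"
  defines "h \<equiv> total_degree G (dims U)"
  shows "\<exists>p q :: nat \<Rightarrow> 'v. span (p ` {..<dim (U g)}) = U g \<and> span (q ` {..<dim (U g)}) = U (inv g \<otimes> h) \<and>
    (\<forall>i<dim (U g). \<forall>j<dim (U g). b (p i) (q j) = (if i = j then 1 else 0)) \<and> (g \<otimes> g = h \<longrightarrow> p = q)"
proof -
  have hc: "h \<in> carrier G" unfolding h_def by (rule total_degree_closed)
  obtain v x :: "'r option \<Rightarrow> 'v" and \<gamma> where v: "span (range v) = UNIV"
    "\<And>i. \<gamma> i \<in> carrier G" "\<And>g. g \<in> carrier G \<Longrightarrow> U g = span (v ` {i. \<gamma> i = g})"
    "\<And>g. g \<in> carrier G \<Longrightarrow> dim (U g) = card {i. \<gamma> i = g}"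
    and x: "\<And>i. x i \<in> U (inv (\<gamma> i) \<otimes> h)"
    "\<And>i j. b (x i) (v j) = (if i = j then 1 else 0)"
    unfolding h_def by (rule homogeneous_dual_bases[OF U]) blast
  have orth: "b z y = 0" if "k \<in> carrier G" "k' \<in> carrier G" "k \<otimes> k' \<noteq> h" "z \<in> U k" "y \<in> U k'" for k k' z y
    using homogeneous_orthogonal[OF U that(1,2)] that(3-5) by (simp add: h_def)
  have hom: "v i \<in> U (\<gamma> i)" for i using v(2,3) by (auto intro: span_base)
  show ?thesis
  proof (cases "g \<otimes> g = h")
    case True
    then have gh: "inv g \<otimes> h = g" using g by (metis inv_solve_left hc)
    \<comment> \<open>A basis vector of degree other than \<open>g\<close> is orthogonal to
      \<open>U g\<close> by cancellation in the group, so a vector in the radical of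
      \<open>U g\<close> is orthogonal to the whole basis.\<close>
    have nd: "z = 0" if z: "z \<in> U g" "\<And>y. y \<in> U g \<Longrightarrow> b z y = 0" for z
    proof (rule eq_0_if_orthogonal[OF v(1)])
      fix s assume "s \<in> range v"
      then obtain i where i: "s = v i" by blast
      show "b z s = 0"
      proof (cases "\<gamma> i = g")
        case True
        then show ?thesis using z(2) hom[of i] i by simp
      next
        case False
        then have "g \<otimes> \<gamma> i \<noteq> h" using True g v(2)[of i] Units_l_cancel[of g "\<gamma> i" g] by auto
        then show ?thesis using orth[OF g v(2)[of i] _ z(1) hom[of i]] i by simp
      qed
    qed
    obtain E where E: "finite E" "independent E" "span E = U g"
      "\<And>x y. x \<in> E \<Longrightarrow> y \<in> E \<Longrightarrow> b x y = (if x = y then 1 else 0)"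
      by (rule orthonormal_basis_exists[OF homogeneous_subspace[OF U g] nd]) blast+
    have "card E = dim (U g)" using E dim_span_eq_card_independent by metis
    then obtain p where p: "bij_betw p {..<dim (U g)} E"
      using ex_bij_betw_nat_finite[OF E(1)] by (auto simp: atLeast0LessThan)
    then have "p ` {..<dim (U g)} = E" "inj_on p {..<dim (U g)}" by (auto simp: bij_betw_def)
    then have "span (p ` {..<dim (U g)}) = U g \<and>
      (\<forall>i<dim (U g). \<forall>j<dim (U g). b (p i) (p j) = (if i = j then 1 else 0))"
      using E(3,4) by (auto simp: inj_on_eq_iff)
    then show ?thesis unfolding gh by blast
  next
    case False
    let ?B = "{i. \<gamma> i = g}"
    obtain f where f: "bij_betw f {..<dim (U g)} ?B"
      using ex_bij_betw_nat_finite[of ?B] v(4)[OF g] by (auto simp: atLeast0LessThan)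
    have fB: "f ` {..<dim (U g)} = ?B" using f by (simp add: bij_betw_def)
    have "span (x ` ?B) = U (inv g \<otimes> h)"
    proof (rule span_subspace)
      show "x ` ?B \<subseteq> U (inv g \<otimes> h)" using x(1) by auto
      show "subspace (U (inv g \<otimes> h))" using homogeneous_subspace[OF U] g hc by simp
      show "U (inv g \<otimes> h) \<subseteq> span (x ` ?B)"
      proof
        fix y assume y: "y \<in> U (inv g \<otimes> h)"
        \<comment> \<open>In the dual expansion of \<open>y\<close>, the coefficient at
          \<open>x i\<close> with \<open>\<gamma> i \<noteq> g\<close> is zero, since the degrees of
          \<open>y\<close> and \<open>v i\<close> do not multiply to \<open>h\<close>.\<close>
        have "scale (b y (v i)) (x i) \<in> span (x ` ?B)" for i
        proof (cases "\<gamma> i = g")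
          case True
          then show ?thesis by (intro span_scale span_base) auto
        next
          case False
          have "inv g \<otimes> h \<otimes> \<gamma> i = h \<otimes> (inv g \<otimes> \<gamma> i)"
            using g hc v(2)[of i] by (simp add: m_ac)
          moreover have "inv g \<otimes> \<gamma> i \<noteq> \<one>"
            using False g v(2)[of i] by (metis inv_solve_left' one_closed r_one)
          ultimately have "inv g \<otimes> h \<otimes> \<gamma> i \<noteq> h"
            using g hc v(2)[of i] by simp
          then have "b y (v i) = 0" using orth[OF _ v(2)[of i] _ y hom] g hc by simp
          then show ?thesis by (simp add: span_zero)
        qed
        then have "(\<Sum>i\<in>UNIV. scale (b y (v i)) (x i)) \<in> span (x ` ?B)" by (intro span_sum)
        then show "y \<in> span (x ` ?B)" using dual_expansion[of UNIV v x y] v(1) x(2) by simp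
      qed
    qed
    moreover have "(v \<circ> f) ` {..<dim (U g)} = v ` ?B" "(x \<circ> f) ` {..<dim (U g)} = x ` ?B"
      using fB by (metis image_comp)+
    ultimately have "span ((v \<circ> f) ` {..<dim (U g)}) = U g" "span ((x \<circ> f) ` {..<dim (U g)}) = U (inv g \<otimes> h)"
      using v(3)[OF g] by metis+
    moreover have "b ((v \<circ> f) i) ((x \<circ> f) j) = (if i = j then 1 else 0)"
      if "i < dim (U g)" "j < dim (U g)" for i j
      using that f x(2)[of "f j" "f i"] b_commute[of "v (f i)"] by (auto simp: bij_betw_def inj_on_eq_iff)
    ultimately show ?thesis using False by blast
  qed
qed

text \<open>Families dual to each other are independent and of equal size, so the two spaces they
  span have equal dimension.\<close>

lemma dim_dual:
  assumes U: "is_grading scale X G U" and g: "g \<in> carrier G"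
  shows "dim (U (inv g \<otimes> total_degree G (dims U))) = dim (U g)"
proof -
  let ?h = "total_degree G (dims U)" and ?I = "{..<dim (U g)}"
  obtain p q :: "nat \<Rightarrow> 'v" where q: "span (q ` ?I) = U (inv g \<otimes> ?h)"
    and pq: "\<forall>i<dim (U g). \<forall>j<dim (U g). b (p i) (q j) = (if i = j then 1 else 0)"
    using dual_graded_bases[OF U g] by blast
  have dual: "b (p i) (q j) = (if i = j then 1 else 0)" if "i \<in> ?I" "j \<in> ?I" for i j
    using pq that by blast
  have "independent (q ` ?I)" using dual by (rule dual_family_independent)
  then have "dim (U (inv g \<otimes> ?h)) = card (q ` ?I)" using q dim_span_eq_card_independent by metis
  also have "\<dots> = dim (U g)" using dual_family_inj_on[of ?I p q, OF dual] by (simp add: card_image)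
  finally show ?thesis .
qed

text \<open>On an orbit \<open>{g, inv g \<otimes> h}\<close> with two elements the bases are chosen for one
  representative and dualized for the other.\<close>

lemma normal_form:
  assumes U: "is_grading scale X G U"
  defines "h \<equiv> total_degree G (dims U)"
  obtains u :: "'g \<Rightarrow> nat \<Rightarrow> 'v" where
    "\<And>g. g \<in> carrier G \<Longrightarrow> span (u g ` {..<dim (U g)}) = U g"
    "\<And>g g' i j. g \<in> carrier G \<Longrightarrow> g' \<in> carrier G \<Longrightarrow> i < dim (U g) \<Longrightarrow> j < dim (U g') \<Longrightarrow>
      b (u g i) (u g' j) = (if g \<otimes> g' = h \<and> i = j then 1 else 0)"
proof -
  have hc: "h \<in> carrier G" unfolding h_def by (rule total_degree_closed)
  have "\<forall>g\<in>carrier G. \<exists>pq :: (nat \<Rightarrow> 'v) \<times> (nat \<Rightarrow> 'v).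
    span (fst pq ` {..<dim (U g)}) = U g \<and> span (snd pq ` {..<dim (U g)}) = U (inv g \<otimes> h) \<and>
    (\<forall>i<dim (U g). \<forall>j<dim (U g). b (fst pq i) (snd pq j) = (if i = j then 1 else 0)) \<and>
    (g \<otimes> g = h \<longrightarrow> fst pq = snd pq)"
    using dual_graded_bases[OF U] unfolding h_def by auto
  from bchoice[OF this] obtain pq :: "'g \<Rightarrow> (nat \<Rightarrow> 'v) \<times> (nat \<Rightarrow> 'v)" where
    pq: "\<And>g. g \<in> carrier G \<Longrightarrow> span (fst (pq g) ` {..<dim (U g)}) = U g"
    "\<And>g. g \<in> carrier G \<Longrightarrow> span (snd (pq g) ` {..<dim (U g)}) = U (inv g \<otimes> h)"
    "\<And>g i j. g \<in> carrier G \<Longrightarrow> i < dim (U g) \<Longrightarrow> j < dim (U g) \<Longrightarrow>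
      b (fst (pq g) i) (snd (pq g) j) = (if i = j then 1 else 0)"
    "\<And>g. g \<in> carrier G \<Longrightarrow> g \<otimes> g = h \<Longrightarrow> fst (pq g) = snd (pq g)"
    by blast
  \<comment> \<open>\<open>\<sigma>\<close> is the involution that sends a degree to the degree of
    the component paired with it.\<close>
  define \<sigma> where "\<sigma> g = inv g \<otimes> h" for g
  have \<sigma>: "\<sigma> g \<in> carrier G" "\<sigma> (\<sigma> g) = g" "dim (U (\<sigma> g)) = dim (U g)" if "g \<in> carrier G" for g
  proof -
    show "\<sigma> g \<in> carrier G" using that hc by (simp add: \<sigma>_def)
    show "\<sigma> (\<sigma> g) = g" using that hc by (simp add: \<sigma>_def inv_mult m_ac)
    show "dim (U (\<sigma> g)) = dim (U g)" using dim_dual[OF U that] by (simp add: \<sigma>_def h_def)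
  qed
  have \<sigma>_iff: "g \<otimes> g' = h \<longleftrightarrow> g' = \<sigma> g" if "g \<in> carrier G" "g' \<in> carrier G" for g g'
    unfolding \<sigma>_def using that hc inv_solve_left[of g' g h] by auto
  \<comment> \<open>The choice depends only on the set \<open>{g, \<sigma> g}\<close>, so both
    members of an orbit receive the same representative.\<close>
  define rep where "rep g = (SOME a. a \<in> {g, \<sigma> g})" for g
  have rep: "rep g = g \<or> rep g = \<sigma> g" for g
    unfolding rep_def using someI[of "\<lambda>a. a \<in> {g, \<sigma> g}" g] by auto
  have rep_\<sigma>: "rep (\<sigma> g) = rep g" if "g \<in> carrier G" for g
    unfolding rep_def \<sigma>(2)[OF that] by (simp add: insert_commute)
  \<comment> \<open>If \<open>g\<close> is not the representative, then \<open>\<sigma> g\<close>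
    is, and the second family chosen there spans the component of degree
    \<open>\<sigma> (\<sigma> g)\<close>, that is, of degree \<open>g\<close>.\<close>
  define u where "u g = (if rep g = g then fst (pq g) else snd (pq (\<sigma> g)))" for g
  show thesis
  proof (rule that[of u])
    fix g assume g: "g \<in> carrier G"
    show "span (u g ` {..<dim (U g)}) = U g"
      using pq(1)[OF g] pq(2)[OF \<sigma>(1)[OF g]] \<sigma>(2,3)[OF g] by (simp add: u_def \<sigma>_def)
  next
    fix g g' i j
    assume g: "g \<in> carrier G" "g' \<in> carrier G" and ij: "i < dim (U g)" "j < dim (U g')"
    have mem: "u k i \<in> U k" if "k \<in> carrier G" "i < dim (U k)" for k i
    proof -
      have "span (u k ` {..<dim (U k)}) = U k"
        using pq(1)[OF that(1)] pq(2)[OF \<sigma>(1)[OF that(1)]] \<sigma>(2,3)[OF that(1)] by (simp add: u_def \<sigma>_def)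
      then show ?thesis using that(2) span_base[of "u k i" "u k ` {..<dim (U k)}"] by auto
    qed
    show "b (u g i) (u g' j) = (if g \<otimes> g' = h \<and> i = j then 1 else 0)"
    proof (cases "g \<otimes> g' = h")
      case False
      then show ?thesis
        using homogeneous_orthogonal[OF U g _ mem[OF g(1) ij(1)] mem[OF g(2) ij(2)]] by (simp add: h_def)
    next
      case True
      then have g': "g' = \<sigma> g" using \<sigma>_iff g by simp
      have ij': "j < dim (U g)" using ij(2) g' \<sigma>(3)[OF g(1)] by simp
      consider "\<sigma> g = g" | "rep g = g" "\<sigma> g \<noteq> g" | "rep g \<noteq> g" "\<sigma> g \<noteq> g" by blast
      then show ?thesis
      proof cases
        \<comment> \<open>At a fixed point of \<open>\<sigma>\<close> the two families coincide, so
          \<open>u g\<close> is orthonormal.\<close>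
        case 1
        then have "u g = fst (pq g)" using rep[of g] by (simp add: u_def)
        then show ?thesis using pq(3)[OF g(1) ij(1) ij'] pq(4)[OF g(1)] True 1 g' by simp
      next
        case 2
        then have "u g = fst (pq g)" "u g' = snd (pq g)"
          using rep_\<sigma>[OF g(1)] \<sigma>(2)[OF g(1)] g' by (simp_all add: u_def)
        then show ?thesis using pq(3)[OF g(1) ij(1) ij'] True by simp
      next
        case 3
        then have "u g = snd (pq g')" "u g' = fst (pq g')"
          using rep[of g] rep_\<sigma>[OF g(1)] g' by (auto simp: u_def)
        then show ?thesis
          using pq(3)[OF g(2) ij(2), of i] ij(1) \<sigma>(3)[OF g(1)] g' True b_commute[of "u g i"] by auto
      qed
    qed
  qed
qed

text \<open>Bases in normal form of the two gradings have the same Gram matrix, so matching them is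
  an isometry that respects components. The scalar that makes it commute with \<open>X\<close>
  leaves every component in place.\<close>

lemma gradings_isomorphic:
  assumes U: "is_grading scale X G U" and W: "is_grading scale X G W"
    and dim: "\<And>g. g \<in> carrier G \<Longrightarrow> dim (W g) = dim (U g)" and r: "CARD('r) \<ge> 2"
  shows "isomorphic_gradings scale X G U W"
proof -
  define h where "h = total_degree G (dims U)"
  have hc: "h \<in> carrier G" unfolding h_def by (rule total_degree_closed)
  have S: "support_on G (dims W) = support_on G (dims U)" by (simp add: support_on_def dim cong: conj_cong del: dim_eq_0)
  \<comment> \<open>The total degree depends only on the dimensions, so both normal forms refer to
    the same \<open>h\<close>.\<close>
  have hW: "total_degree G (dims W) = h"
    unfolding h_def total_degree_def S
    by (rule finprod_cong') (use dim in \<open>auto simp: support_on_def\<close>)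
  obtain u where u: "\<And>g. g \<in> carrier G \<Longrightarrow> span (u g ` {..<dim (U g)}) = U g"
    "\<And>g g' i j. g \<in> carrier G \<Longrightarrow> g' \<in> carrier G \<Longrightarrow> i < dim (U g) \<Longrightarrow> j < dim (U g') \<Longrightarrow>
      b (u g i) (u g' j) = (if g \<otimes> g' = h \<and> i = j then 1 else 0)"
    unfolding h_def by (rule normal_form[OF U]) blast
  obtain w where w: "\<And>g. g \<in> carrier G \<Longrightarrow> span (w g ` {..<dim (W g)}) = W g"
    "\<And>g g' i j. g \<in> carrier G \<Longrightarrow> g' \<in> carrier G \<Longrightarrow> i < dim (W g) \<Longrightarrow> j < dim (W g') \<Longrightarrow>
      b (w g i) (w g' j) = (if g \<otimes> g' = h \<and> i = j then 1 else 0)"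
    unfolding hW[symmetric] by (rule normal_form[OF W]) blast
  \<comment> \<open>Restricting to the support keeps the index set finite for infinite groups; off
    the support there are no basis vectors to index.\<close>
  define A where "A = Sigma (support_on G (dims U)) (\<lambda>g. {..<dim (U g)})"
  have finA: "finite A" unfolding A_def using support_dims(1)[OF U] by blast
  have A_iff: "(g, i) \<in> A \<longleftrightarrow> g \<in> carrier G \<and> i < dim (U g)" for g i
    by (auto simp: A_def support_on_def simp del: dim_eq_0)
  define e where "e = (\<lambda>(g, i). u g i)"
  \<comment> \<open>In the normal form, the vector dual to \<open>u g i\<close> is the one with the
    same number in the paired component.\<close>
  define e' where "e' = (\<lambda>(g, i). u (inv g \<otimes> h) i)"
  define f where "f = (\<lambda>(g, i). w g i)"
  have spans: "span (case_prod t ` A) = UNIV"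
    if T: "is_grading scale X G T" "\<And>g. g \<in> carrier G \<Longrightarrow> span (t g ` {..<dim (U g)}) = T g" for T and t
  proof -
    have "T g \<subseteq> span (case_prod t ` A)" if "g \<in> carrier G" for g
      unfolding T(2)[OF that, symmetric] by (intro span_mono) (use A_iff that in force)
    then have "(\<Union>g\<in>carrier G. T g) \<subseteq> span (case_prod t ` A)" by blast
    then have "span (\<Union>g\<in>carrier G. T g) \<subseteq> span (case_prod t ` A)" by (intro span_minimal) auto
    then show ?thesis using direct_sum_span[of "carrier G" T] T(1) unfolding is_grading_def by auto
  qed
  have e_span: "span (e ` A) = UNIV" unfolding e_def using U u(1) by (rule spans)
  have f_span: "span (f ` A) = UNIV" unfolding f_def using W w(1) dim by (intro spans) auto
  have dual: "b (e' k) (e l) = (if k = l then 1 else 0)" if "k \<in> A" "l \<in> A" for k l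
  proof -
    obtain g i g' j where kl: "k = (g, i)" "l = (g', j)" by fastforce
    have g: "g \<in> carrier G" "i < dim (U g)" "g' \<in> carrier G" "j < dim (U g')"
      using that A_iff kl by auto
    have "inv g \<otimes> h \<otimes> g' = h \<longleftrightarrow> h \<otimes> g' = g \<otimes> h"
      using g hc by (simp add: m_assoc inv_solve_left')
    also have "\<dots> \<longleftrightarrow> g = g'" using g hc m_comm[of g h] Units_l_cancel[of h g' g] by auto
    finally have "inv g \<otimes> h \<otimes> g' = h \<longleftrightarrow> g = g'" .
    then show ?thesis
      using u(2)[of "inv g \<otimes> h" g' i j] g hc dim_dual[OF U g(1)] by (auto simp: kl e'_def e_def h_def)
  qed
  have gram: "b (f k) (f l) = b (e k) (e l)" if "k \<in> A" "l \<in> A" for k l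
  proof -
    obtain g i g' j where kl: "k = (g, i)" "l = (g', j)" by fastforce
    have g: "g \<in> carrier G" "i < dim (U g)" "g' \<in> carrier G" "j < dim (U g')"
      using that A_iff kl by auto
    then show ?thesis using u(2)[of g g' i j] w(2)[of g g' i j] dim by (simp add: kl e_def f_def)
  qed
  obtain \<phi> where \<phi>: "Vector_Spaces.linear scale scale \<phi>" "bij \<phi>" "\<And>x y. b (\<phi> x) (\<phi> y) = b x y"
    "\<And>k. k \<in> A \<Longrightarrow> \<phi> (e k) = f k"
    by (rule isometry_exists[OF finA e_span f_span dual gram]) blast+
  interpret \<phi>: Vector_Spaces.linear scale scale \<phi> by (rule \<phi>(1))
  obtain \<mu> where \<mu>: "\<mu> \<noteq> 0" "\<And>w. scale \<mu> (\<phi> (X w)) = X (\<lambda>i. scale \<mu> (\<phi> (w i)))"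
    by (rule scaled_isometry_preserves_X[OF \<phi>(1-3) r]) blast
  define \<psi> where "\<psi> x = scale \<mu> (\<phi> x)" for x
  have "Vector_Spaces.linear scale scale \<psi>"
    by unfold_locales (simp_all add: \<psi>_def \<phi>.add \<phi>.scale scale_right_distrib mult.commute)
  moreover have "bij \<psi>"
  proof (rule bijI)
    show "inj \<psi>" using \<mu>(1) bij_is_inj[OF \<phi>(2)] by (auto simp: \<psi>_def inj_def)
    have "\<exists>x. \<psi> x = y" for y
    proof -
      obtain x where "\<phi> x = scale (inverse \<mu>) y" using bij_is_surj[OF \<phi>(2)] by (metis surjD)
      then show ?thesis using \<mu>(1) by (intro exI[of _ x]) (simp add: \<psi>_def)
    qed
    then show "surj \<psi>" by (metis surjI)
  qed
  moreover have "\<psi> (X v) = X (\<lambda>i. \<psi> (v i))" for v using \<mu>(2) by (simp add: \<psi>_def)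
  moreover have "\<psi> ` U g = W g" if g: "g \<in> carrier G" for g
  proof -
    have "\<phi> ` u g ` {..<dim (U g)} = w g ` {..<dim (U g)}"
      unfolding image_image
    proof (intro image_cong)
      fix i assume "i \<in> {..<dim (U g)}"
      then show "\<phi> (u g i) = w g i" using \<phi>(4)[of "(g, i)"] A_iff g by (simp add: e_def f_def)
    qed simp
    then have "\<phi> ` U g = W g"
      using \<phi>.span_image[of "u g ` {..<dim (U g)}"] u(1)[OF g] w(1)[OF g] dim[OF g] by simp
    then have "\<psi> ` U g = scale \<mu> ` W g" by (force simp: \<psi>_def)
    also have "\<dots> = W g"
    proof (intro equalityI subsetI)
      fix y assume y: "y \<in> W g"
      then have "scale (inverse \<mu>) y \<in> W g" using homogeneous_subspace[OF W g] subspace_scale by blast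
      moreover have "y = scale \<mu> (scale (inverse \<mu>) y)" using \<mu>(1) by simp
      ultimately show "y \<in> scale \<mu> ` W g" by blast
    qed (use homogeneous_subspace[OF W g] subspace_scale in blast)
    finally show ?thesis .
  qed
  ultimately show ?thesis unfolding isomorphic_gradings_def by blast
qed

end

section \<open>Existence and uniqueness of the dimension function\<close>

theorem theorem4p2:
  fixes smul :: "'f::alg_closed_field \<Rightarrow> 'v::ab_group_add \<Rightarrow> 'v"
    and b :: "'v \<Rightarrow> 'v \<Rightarrow> 'f"
    and X :: "('r::finite \<Rightarrow> 'v) \<Rightarrow> 'v"
    and n :: nat
    and G :: "('g, 'm) monoid_scheme" (structure)
    and U :: "'g \<Rightarrow> 'v set"
  assumes "CHAR('f) \<noteq> 2"
    and "n \<ge> 3"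
    and "vector_space smul"
    and "vector_space.dim smul UNIV = n"
    and "CARD('r) = n - 1"
    and "bilinear_form smul b" "symmetric_form b" "nondegenerate_form b"
    and "cross_product smul b X"
    and "comm_group G"
    and "is_grading smul X G U"
  shows "\<exists>!\<delta>. \<delta> \<in> carrier G \<rightarrow>\<^sub>E UNIV \<and>
           finite (support_on G \<delta>) \<and> (\<Sum>g\<in>support_on G \<delta>. \<delta> g) = n \<and>
           (\<forall>g\<in>carrier G. \<delta> g = \<delta> (inv g \<otimes> total_degree G \<delta>)) \<and>
           isomorphic_to_Gamma smul b X G \<delta> U"
proof -
  interpret V: vector_space smul by fact
  obtain B where B: "V.independent B" "V.span B = UNIV" "card B = n"
    using V.basis_exists[of UNIV] assms(4) by (metis top.extremum_uniqueI)
  have "finite B" using B(3) assms(2) by (metis card.infinite not_numeral_le_zero)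
  have "\<not> CHAR('f) dvd 2"
  proof
    assume dvd: "CHAR('f) dvd 2"
    then have "CHAR('f) \<le> 2" by (rule dvd_imp_le) simp
    moreover have "CHAR('f) \<noteq> 0" using dvd by (metis dvd_0_left_iff zero_neq_numeral)
    moreover have "CHAR('f) \<noteq> 1" by simp
    ultimately show False using assms(1) by linarith
  qed
  then have two: "(2 :: 'f) \<noteq> 0" using of_nat_eq_0_iff_char_dvd[where 'a = 'f, of 2] by simp
  interpret comm_group G by fact
  interpret cross_product_graded_by smul B b X G
    using \<open>finite B\<close> B two assms
    by unfold_locales auto
  note U = assms(11)
  \<comment> \<open>The dimension function is the only candidate. It is made undefined off the
    carrier so that uniqueness as a function on the whole type makes sense.\<close>
  define \<delta> where "\<delta> = restrict (\<lambda>g. V.dim (U g)) (carrier G)"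
  have S: "support_on G \<delta> = support_on G (\<lambda>g. V.dim (U g))" by (auto simp: support_on_def \<delta>_def simp del: dim_eq_0)
  have h: "total_degree G \<delta> = total_degree G (\<lambda>g. V.dim (U g))"
    unfolding total_degree_def S
    by (rule finprod_cong') (auto simp: support_on_def \<delta>_def simp del: dim_eq_0)
  have S_carrier: "support_on G (\<lambda>g. V.dim (U g)) \<subseteq> carrier G" by (auto simp: support_on_def)
  \<comment> \<open>The grading \<open>U\<close> is itself a representative, which settles the
    existence part of \<open>isomorphic_to_Gamma\<close>.\<close>
  have \<Gamma>: "is_Gamma smul b X G \<delta> U"
    unfolding is_Gamma_def h using U homogeneous_orthogonal[OF U] by (auto simp: \<delta>_def)
  show ?thesis
  proof (rule ex1I[of _ \<delta>], intro conjI ballI)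
    show "\<delta> \<in> carrier G \<rightarrow>\<^sub>E UNIV" by (auto simp: \<delta>_def)
    show "finite (support_on G \<delta>)" unfolding S by (rule support_dims(1)[OF U])
    have "(\<Sum>g\<in>support_on G \<delta>. \<delta> g) = (\<Sum>g\<in>support_on G (\<lambda>g. V.dim (U g)). V.dim (U g))"
      unfolding S by (intro sum.cong) (use S_carrier in \<open>auto simp: \<delta>_def\<close>)
    then show "(\<Sum>g\<in>support_on G \<delta>. \<delta> g) = n" using support_dims(2)[OF U] assms(2,5) by simp
    show "\<delta> g = \<delta> (inv g \<otimes> total_degree G \<delta>)" if "g \<in> carrier G" for g
      unfolding h using that dim_dual[OF U that] total_degree_closed by (simp add: \<delta>_def)
    show "isomorphic_to_Gamma smul b X G \<delta> U"
      unfolding isomorphic_to_Gamma_def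
    proof (intro conjI allI impI)
      fix W assume "is_Gamma smul b X G \<delta> W"
      then have "is_grading smul X G W" "\<And>g. g \<in> carrier G \<Longrightarrow> V.dim (W g) = V.dim (U g)"
        unfolding is_Gamma_def by (auto simp: \<delta>_def)
      then show "isomorphic_gradings smul X G U W"
        by (intro gradings_isomorphic U) (use assms(2,5) in auto)
    qed (use \<Gamma> in blast)
  next
    fix \<delta>'
    assume *: "\<delta>' \<in> carrier G \<rightarrow>\<^sub>E UNIV \<and>
           finite (support_on G \<delta>') \<and> (\<Sum>g\<in>support_on G \<delta>'. \<delta>' g) = n \<and>
           (\<forall>g\<in>carrier G. \<delta>' g = \<delta>' (inv g \<otimes> total_degree G \<delta>')) \<and>
           isomorphic_to_Gamma smul b X G \<delta>' U"
    then obtain W where W: "is_Gamma smul b X G \<delta>' W" "isomorphic_gradings smul X G U W"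
      unfolding isomorphic_to_Gamma_def by blast
    then obtain \<phi> where \<phi>: "Vector_Spaces.linear smul smul \<phi>" "bij \<phi>" "\<And>g. g \<in> carrier G \<Longrightarrow> \<phi> ` U g = W g"
      unfolding isomorphic_gradings_def by blast
    interpret P: finite_dimensional_vector_space_pair_1 smul B smul by unfold_locales
    have "\<delta>' g = \<delta> g" if g: "g \<in> carrier G" for g
    proof -
      \<comment> \<open>An isomorphism of gradings preserves the dimension of each component, which
        determines \<open>\<delta>'\<close> on the carrier.\<close>
      have "V.dim (\<phi> ` U g) = V.dim (U g)"
        by (rule P.dim_image_eq[OF \<phi>(1)]) (use bij_is_inj[OF \<phi>(2)] in \<open>auto intro: inj_on_subset\<close>)
      then show ?thesis using W(1) \<phi>(3)[OF g] g unfolding is_Gamma_def by (simp add: \<delta>_def)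
    qed
    then show "\<delta>' = \<delta>" using * by (intro extensionalityI[of _ "carrier G"]) (auto simp: \<delta>_def PiE_def)
  qed
qed

end
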